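(* For every integer $n\ge 1$, let $A_n$ (resp. $B_n$) be the number of lattice paths from $(0,0)$ to $(5n-1,2n-1)$ with East steps $(1,0)$ and North steps $(0,1)$ all of whose points $(x,y)$ satisfy $y\le \frac25x+\frac15$ (resp. $y\le\frac25 x$). Then $$A_n+B_n=\frac{2}{7n-1}\binom{7n-1}{2n}.$$
   Context: All the notation is introduced in the claim. Touching the boundary line is allowed. Equivalently, $A_n$ counts walks with $7n-2$ jumps in $\{-2,+5\}$ staying at altitude $\ge0$, starting at altitude $4$ and ending at altitude $1$; $B_n$ counts such walks starting at altitude $3$ and ending at altitude $0$. *)

theory Defs
  imports Complex_Main "HOL-Library.Product_Plus"
begin

text \<open>A lattice path is represented by the non-empty list of the lattice points it visits.\<close>

definition lattice_path :: "(int \<times> int) list \<Rightarrow> bool" where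
  "lattice_path p \<longleftrightarrow>
     p \<noteq> [] \<and> successively (\<lambda>P Q. Q = P + (1, 0) \<or> Q = P + (0, 1)) p"

text \<open>Only the lattice points of a path are required to lie weakly below the line.
  For the nonnegative slopes used here, this is equivalent to the same condition on all points of
  the corresponding polygonal line: on an East step the left end is the critical one,
  on a North step the top end.\<close>

definition paths_below :: "real \<Rightarrow> real \<Rightarrow> int \<times> int \<Rightarrow> int \<times> int \<Rightarrow> (int \<times> int) list set" where
  "paths_below a b P Q =
     {p. lattice_path p \<and> hd p = P \<and> last p = Q \<and>
         (\<forall>(x, y) \<in> set p. real_of_int y \<le> a * real_of_int x + b)}"

definition A :: "nat \<Rightarrow> nat" where
  "A n = card (paths_below (2/5) (1/5) (0, 0) (5 * int n - 1, 2 * int n - 1))"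

definition B :: "nat \<Rightarrow> nat" where
  "B n = card (paths_below (2/5) 0 (0, 0) (5 * int n - 1, 2 * int n - 1))"

end

theory Submission
  imports Defs "HOL-Combinatorics.Multiset_Permutations"
begin

text \<open>Give an East step the weight \<open>2\<close> and a North step the weight \<open>-5\<close>. Appending a final North step
  turns the paths counted by \<open>A n\<close> (resp. \<open>B n\<close>) into the words with \<open>5 n - 1\<close> East and \<open>2 n\<close> North
  steps, of total weight \<open>-2\<close>, all of whose proper prefixes have weight at least \<open>-1\<close>
  (resp. at least \<open>0\<close>). Extend the prefix sums of such a word periodically. The number of the
  two conditions that a rotation of the word satisfies is the amount by which the running minimum
  drops at the corresponding place. Over one period the running minimum drops by exactly \<open>2\<close>, so
  averaging over all \<open>7 n - 1\<close> rotations gives the formula.\<close>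

section \<open>A cycle lemma\<close>

text \<open>Used with \<open>\<mu> = M r - S r\<close> to turn the number of satisfied thresholds
  into a drop of the running minimum; the \<open>max\<close> covers the case where no
  \<open>c < d\<close> qualifies.\<close>

lemma card_nat_ge_neg:
  fixes \<mu> :: int
  assumes "\<mu> \<le> 0"
  shows "int (card {c. c < d \<and> - int c \<le> \<mu>}) = max 0 (int d + \<mu>)"
proof -
  have "{c. c < d \<and> - int c \<le> \<mu>} = {nat (- \<mu>)..<d}"
    using assms by auto
  then show ?thesis
    using assms by auto
qed

text \<open>In the periodic extension of \<open>w\<close>, rotating only shifts the starting index,
  so prefix sums become differences of partial sums.\<close>

lemma sum_list_take_rotate:
  fixes w :: "'a::ab_group_add list"
  assumes "j \<le> length w"
  shows "sum_list (take j (rotate r w)) =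
    (\<Sum>i<r + j. w ! (i mod length w)) - (\<Sum>i<r. w ! (i mod length w))"
proof -
  have "sum_list (take j (rotate r w)) = (\<Sum>i<j. take j (rotate r w) ! i)"
    using assms by (simp add: sum_list_sum_nth lessThan_atLeast0)
  also have "\<dots> = (\<Sum>i<j. w ! ((r + i) mod length w))"
    using assms by (intro sum.cong) (auto simp: nth_rotate)
  also have "\<dots> = (\<Sum>i<r + j. w ! (i mod length w)) - (\<Sum>i<r. w ! (i mod length w))"
    by (induction j) (auto simp: algebra_simps)
  finally show ?thesis .
qed

lemma mset_rotate [simp]: "mset (rotate r w) = mset w"
  by (metis append_take_drop_id mset_append rotate_drop_take union_commute)

text \<open>For \<open>d = 1\<close> this is the classical statement that exactly one rotation has
  all proper prefix sums nonnegative. For larger \<open>d\<close> a single rotation may satisfy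
  several thresholds, so these are counted together and the counts telescope.\<close>

theorem cycle_lemma:
  fixes w :: "int list"
  assumes total: "sum_list w = - int d" and "w \<noteq> []"
  shows "(\<Sum>r<length w. card {c. c < d \<and>
      (\<forall>j<length w. - int c \<le> sum_list (take j (rotate r w)))}) = d"
proof -
  define m where "m = length w"
  define S where "S k = (\<Sum>i<k. w ! (i mod m))" for k
  \<comment> \<open>The window holds the empty and all other proper prefixes of the rotation by
    \<open>r\<close>. As \<open>S\<close> falls by \<open>d\<close> per period, \<open>M r\<close>
    is also the minimum of all \<open>S k\<close> with \<open>k < r + m\<close>.\<close>
  define M where "M r = Min (S ` {r..<r + m})" for r
  have "m > 0"
    using assms by (simp add: m_def)
  have prefix: "sum_list (take j (rotate r w)) = S (r + j) - S r" if "j \<le> m" for j r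
    using sum_list_take_rotate[of j w r] that by (simp add: S_def m_def)
  have period: "S (r + m) = S r - int d" for r
  proof -
    have "sum_list (rotate r w) = sum_list w"
      by (metis mset_rotate sum_mset_sum_list)
    then show ?thesis
      using prefix[of m r] total by (simp add: m_def)
  qed
  have M_le: "M r \<le> S r" for r
    unfolding M_def using \<open>m > 0\<close> by (intro Min_le) auto
  have M_Suc: "M (Suc r) = min (M r) (S (r + m))" for r
  proof -
    have ne: "{r..<r + m} \<noteq> {}"
      using \<open>m > 0\<close> by simp
    have "insert r {Suc r..<Suc r + m} = insert (r + m) {r..<r + m}"
      using \<open>m > 0\<close> by auto
    then have "Min (insert (S r) (S ` {Suc r..<Suc r + m})) = min (S (r + m)) (M r)"
      using ne unfolding M_def by (metis Min_insert finite_atLeastLessThan finite_imageI image_insert image_is_empty)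
    then have "min (S r) (M (Suc r)) = min (S (r + m)) (M r)"
      using \<open>m > 0\<close> by (simp add: M_def)
    \<comment> \<open>With \<open>period\<close> this gives \<open>M (Suc r) <= S r\<close>, so the
      left-hand minimum above is \<open>M (Suc r)\<close>.\<close>
    moreover have "M (Suc r) \<le> S (r + m)"
      unfolding M_def using \<open>m > 0\<close> by (intro Min_le) auto
    ultimately show ?thesis
      using period[of r] by linarith
  qed
  have M_period: "M (r + m) = M r - int d" for r
  proof -
    have "{r + m..<r + m + m} = (\<lambda>k. k + m) ` {r..<r + m}"
      by simp
    then have "S ` {r + m..<r + m + m} = (\<lambda>x. x - int d) ` S ` {r..<r + m}"
      by (simp add: image_image period del: image_add_atLeastLessThan')
    moreover have "mono (\<lambda>x. x - int d)"
      by (simp add: mono_def)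
    ultimately show ?thesis
      using mono_Min_commute[of "\<lambda>x. x - int d" "S ` {r..<r + m}"] \<open>m > 0\<close> by (simp add: M_def)
  qed
  \<comment> \<open>By \<open>M_Suc\<close> and \<open>period\<close>, the right side is
    \<open>max 0 (d + (M r - S r))\<close>.\<close>
  have drop: "int (card {c. c < d \<and> (\<forall>j<m. - int c \<le> sum_list (take j (rotate r w)))})
      = M r - M (Suc r)" for r
  proof -
    have "(\<forall>j<m. - int c \<le> sum_list (take j (rotate r w))) \<longleftrightarrow> - int c \<le> M r - S r" for c
    proof -
      have "- int c \<le> M r - S r \<longleftrightarrow> S r - int c \<le> Min (S ` {r..<r + m})"
        unfolding M_def by linarith
      also have "\<dots> \<longleftrightarrow> (\<forall>k\<in>{r..<r + m}. S r - int c \<le> S k)"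
        using \<open>m > 0\<close> by simp
      also have "\<dots> \<longleftrightarrow> (\<forall>j<m. S r - int c \<le> S (r + j))"
        by (fastforce simp: nat_le_iff_add)
      also have "\<dots> \<longleftrightarrow> (\<forall>j<m. - int c \<le> sum_list (take j (rotate r w)))"
        by (auto simp: prefix algebra_simps)
      finally show ?thesis
        by simp
    qed
    then show ?thesis
      using card_nat_ge_neg[of "M r - S r" d] M_le[of r] M_Suc[of r] period[of r] by simp
  qed
  have "int (\<Sum>r<m. card {c. c < d \<and> (\<forall>j<m. - int c \<le> sum_list (take j (rotate r w)))})
      = (\<Sum>r<m. M r - M (Suc r))"
    by (simp add: drop)
  also have "\<dots> = M 0 - M m"
    by (rule sum_lessThan_telescope')
  also have "\<dots> = int d"
    using M_period[of 0] by simp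
  finally show ?thesis
    by (simp only: m_def of_nat_eq_iff)
qed

lemma bij_betw_rotate_permutations_of_multiset:
  "bij_betw (rotate r) (permutations_of_multiset X) (permutations_of_multiset X)"
proof -
  have "inj_on (rotate r) (permutations_of_multiset X)"
    by (simp add: rotate_def inj_on_subset[OF inj_fn[OF inj_rotate1]])
  moreover have "rotate r ` permutations_of_multiset X \<subseteq> permutations_of_multiset X"
    by (auto simp: permutations_of_multiset_def)
  ultimately show ?thesis
    by (simp add: bij_betw_def endo_inj_surj)
qed

text \<open>Double counting of pairs of a word and a threshold: rotations permute the words, so
  averaging over them changes nothing, and the cycle lemma gives \<open>d\<close> for each
  word.\<close>

theorem sum_card_prefix_bounded:
  fixes g :: "'a \<Rightarrow> int"
  assumes total: "(\<Sum>x\<in>#X. g x) = - int d" and "X \<noteq> {#}"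
  shows "size X * (\<Sum>c<d. card {w \<in> permutations_of_multiset X.
      \<forall>j<size X. - int c \<le> sum_list (map g (take j w))}) = d * card (permutations_of_multiset X)"
proof -
  define L where "L = permutations_of_multiset X"
  define P where "P c w \<longleftrightarrow> (\<forall>j<size X. - int c \<le> sum_list (map g (take j w)))" for c w
  have "finite L"
    by (simp add: L_def)
  have "(\<Sum>c<d. card {w \<in> L. P c w}) = (\<Sum>c<d. \<Sum>w\<in>L. if P c w then 1 else 0)"
    using \<open>finite L\<close> by (simp add: sum.If_cases Int_def)
  also have "\<dots> = (\<Sum>w\<in>L. \<Sum>c<d. if P c w then 1 else 0)"
    by (rule sum.swap)
  also have "\<dots> = (\<Sum>w\<in>L. card {c. c < d \<and> P c w})"
    by (simp add: sum.If_cases Int_def)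
  finally have swap: "(\<Sum>c<d. card {w \<in> L. P c w}) = (\<Sum>w\<in>L. card {c. c < d \<and> P c w})" .
  have rot: "(\<Sum>w\<in>L. card {c. c < d \<and> P c w}) = (\<Sum>w\<in>L. card {c. c < d \<and> P c (rotate r w)})" for r
    using sum.reindex_bij_betw[OF bij_betw_rotate_permutations_of_multiset[of r X],
        of "\<lambda>w. card {c. c < d \<and> P c w}"]
    by (simp add: L_def)
  have "size X * (\<Sum>c<d. card {w \<in> L. P c w})
      = (\<Sum>r<size X. \<Sum>w\<in>L. card {c. c < d \<and> P c (rotate r w)})"
    by (simp add: swap rot[symmetric])
  also have "\<dots> = (\<Sum>w\<in>L. \<Sum>r<size X. card {c. c < d \<and> P c (rotate r w)})"
    by (rule sum.swap)
  also have "\<dots> = (\<Sum>w\<in>L. d)"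
  proof (rule sum.cong)
    fix w assume "w \<in> L"
    then have w: "mset w = X"
      by (simp add: L_def permutations_of_multiset_def)
    then have "sum_list (map g w) = - int d"
      using total by (metis mset_map sum_mset_sum_list)
    moreover have "map g w \<noteq> []" "length (map g w) = size X"
      using w \<open>X \<noteq> {#}\<close> by auto
    ultimately show "(\<Sum>r<size X. card {c. c < d \<and> P c (rotate r w)}) = d"
      using cycle_lemma[of "map g w" d] by (simp add: P_def rotate_map take_map)
  qed simp
  finally show ?thesis
    by (simp add: L_def P_def mult.commute)
qed

section \<open>Lattice paths as words of steps\<close>

primrec walk :: "'a::monoid_add \<Rightarrow> 'a list \<Rightarrow> 'a list" where
  "walk P [] = [P]"
| "walk P (s # u) = P # walk (P + s) u"

lemma walk_not_Nil [simp]: "walk P u \<noteq> []"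
  by (cases u) auto

lemma hd_walk [simp]: "hd (walk P u) = P"
  by (cases u) auto

lemma last_walk: "last (walk P u) = P + sum_list u"
  by (induction u arbitrary: P) (auto simp: add.assoc)

lemma set_walk: "set (walk P u) = (\<lambda>j. P + sum_list (take j u)) ` {..length u}"
  by (induction u arbitrary: P)
    (simp_all add: atMost_Suc_eq_insert_0 image_image add.assoc)

text \<open>Cancellation recovers each step from two consecutive points, so counting paths reduces
  to counting words of steps.\<close>

lemma inj_walk: "inj (walk (P :: 'a::group_add))"
proof (rule injI)
  fix u v assume "walk P u = walk P v"
  then show "u = v"
  proof (induction u arbitrary: P v)
    case Nil
    then show ?case
      by (cases v) (auto dest: arg_cong[where f = length])
  next
    case (Cons s u)
    then obtain t v' where v: "v = t # v'"
      by (cases v) auto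
    with Cons.prems have "walk (P + s) u = walk (P + t) v'"
      by simp
    then have "s = t"
      by (metis add_left_imp_eq hd_walk)
    with Cons v show ?case
      by auto
  qed
qed

lemma lattice_path_walk: "set u \<subseteq> {(1, 0), (0, 1)} \<Longrightarrow> lattice_path (walk P u)"
proof (induction u arbitrary: P)
  case Nil
  then show ?case by (simp add: lattice_path_def)
next
  case (Cons s u)
  then have "lattice_path (walk (P + s) u)"
    by simp
  with Cons.prems show ?case
    by (auto simp: lattice_path_def successively_Cons)
qed

lemma lattice_path_imp_walk:
  "lattice_path p \<Longrightarrow> \<exists>u. set u \<subseteq> {(1, 0), (0, 1)} \<and> p = walk (hd p) u"
proof (induction p)
  case Nil
  then show ?case by (simp add: lattice_path_def)
next
  case (Cons P p)
  show ?case
  proof (cases "p = []")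
    case True
    then show ?thesis
      by (intro exI[of _ "[]"]) simp
  next
    case False
    with Cons.prems have "lattice_path p" and step: "hd p = P + (1, 0) \<or> hd p = P + (0, 1)"
      by (auto simp: lattice_path_def successively_Cons)
    with Cons.IH obtain u where u: "set u \<subseteq> {(1, 0), (0, 1)}" "p = walk (hd p) u"
      by blast
    from step obtain s where "s \<in> {(1, 0), (0, 1)}" "hd p = P + s"
      by blast
    with u show ?thesis
      by (intro exI[of _ "s # u"]) auto
  qed
qed

lemma paths_below_eq_walk:
  "paths_below a b P Q = walk P ` {u. set u \<subseteq> {(1, 0), (0, 1)} \<and> P + sum_list u = Q \<and>
     (\<forall>j\<le>length u. case P + sum_list (take j u) of (x, y) \<Rightarrow> real_of_int y \<le> a * real_of_int x + b)}"
  (is "_ = walk P ` ?U")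
proof
  show "paths_below a b P Q \<subseteq> walk P ` ?U"
  proof
    fix p assume p: "p \<in> paths_below a b P Q"
    then obtain u where u: "set u \<subseteq> {(1, 0), (0, 1)}" "p = walk P u"
      using lattice_path_imp_walk[of p] by (auto simp: paths_below_def)
    with p have "u \<in> ?U"
      by (auto simp: paths_below_def last_walk set_walk)
    with u show "p \<in> walk P ` ?U"
      by blast
  qed
  show "walk P ` ?U \<subseteq> paths_below a b P Q"
    by (fastforce simp: paths_below_def last_walk set_walk lattice_path_walk)
qed

text \<open>The displacement of such a word records how often each letter occurs, so fixing the end
  point means fixing the multiset of steps.\<close>

lemma sum_list_steps_eq_iff:
  "set u \<subseteq> {(1, 0), (0, 1)} \<and> sum_list u = (int a, int b) \<longleftrightarrow>
   mset u = replicate_mset a (1, 0) + replicate_mset b (0, 1)" (is "?l \<longleftrightarrow> ?r")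
proof
  have sum: "sum_list u = (int (count_list u (1, 0)), int (count_list u (0, 1)))"
    and mset: "mset u = replicate_mset (count_list u (1, 0)) (1, 0) +
      replicate_mset (count_list u (0, 1)) (0, 1)"
    if "set u \<subseteq> {(1 :: int, 0 :: int), (0, 1)}"
    using that by (induction u) (auto simp: zero_prod_def)
  show ?r if ?l
  proof -
    from that have "set u \<subseteq> {(1, 0), (0, 1)}" by blast
    from sum[OF this] mset[OF this] that show ?thesis by simp
  qed
  show ?l if ?r
  proof -
    have "set u \<subseteq> {(1, 0), (0, 1)}"
      using arg_cong[OF that, of set_mset] by (auto split: if_splits)
    moreover have "count_list u (1, 0) = a" "count_list u (0, 1) = b"
      using that by (simp_all flip: count_mset)
    ultimately show ?thesis
      using sum by simp
  qed
qed

section \<open>Slope two fifths\<close>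

text \<open>At a point, this is five times the signed vertical distance up to the line
  \<open>y = 2x/5\<close>; lying weakly below \<open>y = 2x/5 + c/5\<close> means weight at least
  \<open>-c\<close>.\<close>

abbreviation (input) weight :: "int \<times> int \<Rightarrow> int" where
  "weight s \<equiv> 2 * fst s - 5 * snd s"

lemma sum_list_weight: "sum_list (map (\<lambda>s. weight s) u) = weight (sum_list u)"
  by (induction u) auto

text \<open>Appending a North step is a bijection from the step words of the paths onto the words on
  the right.\<close>

lemma card_paths_below_eq:
  assumes "n \<ge> 1" and "c < 2"
  shows "card (paths_below (2/5) (real c / 5) (0, 0) (5 * int n - 1, 2 * int n - 1)) =
    card {w \<in> permutations_of_multiset
        (replicate_mset (5 * n - 1) (1, 0) + replicate_mset (2 * n) (0, 1)).
      \<forall>j<7 * n - 1. - int c \<le> sum_list (map (\<lambda>s. weight s) (take j w))}"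
    (is "_ = card ?W")
proof -
  define U where "U = {u. mset u = replicate_mset (5 * n - 1) (1, 0) + replicate_mset (2 * n - 1) (0, 1) \<and>
    (\<forall>j\<le>length u. - int c \<le> sum_list (map (\<lambda>s. weight s) (take j u)))}"
  have len: "length u = 7 * n - 2"
    if "mset u = replicate_mset (5 * n - 1) (1, 0) + replicate_mset (2 * n - 1) (0, 1)"
    for u :: "(int \<times> int) list"
    using arg_cong[OF that, of size] \<open>n \<ge> 1\<close> by simp
  have line: "real_of_int y \<le> 2/5 * real_of_int x + real c / 5 \<longleftrightarrow> - int c \<le> 2 * x - 5 * y" for x y
  proof -
    have "real_of_int y \<le> 2/5 * real_of_int x + real c / 5 \<longleftrightarrow>
        real_of_int (- int c) \<le> real_of_int (2 * x - 5 * y)"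
      by (simp add: field_simps)
    then show ?thesis
      by (simp only: of_int_le_iff)
  qed
  have "paths_below (2/5) (real c / 5) (0, 0) (5 * int n - 1, 2 * int n - 1) = walk (0, 0) ` U"
    unfolding paths_below_eq_walk U_def
    using sum_list_steps_eq_iff[of _ "5 * n - 1" "2 * n - 1"] \<open>n \<ge> 1\<close>
    by (intro arg_cong[where f = "image _"])
      (auto simp: sum_list_weight line case_prod_beta of_nat_diff simp flip: zero_prod_def)
  then have "card (paths_below (2/5) (real c / 5) (0, 0) (5 * int n - 1, 2 * int n - 1)) = card U"
    by (simp add: card_image inj_on_subset[OF inj_walk])
  also have "\<dots> = card ((\<lambda>u. u @ [(0, 1)]) ` U)"
    by (simp add: card_image inj_on_def)
  also have "(\<lambda>u. u @ [(0, 1)]) ` U = ?W"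
  proof (intro set_eqI iffI)
    fix w assume "w \<in> (\<lambda>u. u @ [(0, 1)]) ` U"
    then obtain u where w: "w = u @ [(0, 1)]" and "u \<in> U"
      by blast
    then have u: "mset u = replicate_mset (5 * n - 1) (1, 0) + replicate_mset (2 * n - 1) (0, 1)"
      and prefix: "\<And>j. j \<le> length u \<Longrightarrow> - int c \<le> sum_list (map (\<lambda>s. weight s) (take j u))"
      by (auto simp: U_def)
    have "2 * n = Suc (2 * n - 1)"
      using \<open>n \<ge> 1\<close> by simp
    then have "mset w = replicate_mset (5 * n - 1) (1, 0) + replicate_mset (2 * n) (0, 1)"
      using u w by (metis add_mset_add_single mset_append mset_single_iff_right replicate_mset_Suc union_assoc)
    \<comment> \<open>The proper prefixes of \<open>w\<close> are exactly the prefixes of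
      \<open>u\<close>, including \<open>u\<close> itself.\<close>
    then show "w \<in> ?W"
      using prefix len[OF u] w by (auto simp: permutations_of_multiset_def)
  next
    fix w assume "w \<in> ?W"
    then have w: "mset w = replicate_mset (5 * n - 1) (1, 0) + replicate_mset (2 * n) (0, 1)"
      and prefix: "\<And>j. j < 7 * n - 1 \<Longrightarrow> - int c \<le> sum_list (map (\<lambda>s. weight s) (take j w))"
      by (auto simp: permutations_of_multiset_def)
    have length_w: "length w = 7 * n - 1"
      using arg_cong[OF w, of size] \<open>n \<ge> 1\<close> by simp
    then obtain u s where us: "w = u @ [s]"
      using \<open>n \<ge> 1\<close> by (cases w rule: rev_cases) auto
    have length_u: "length u = 7 * n - 2"
      using us length_w by simp
    have step: "s = (1, 0) \<or> s = (0, 1)" and total: "sum_list w = (int (5 * n - 1), int (2 * n))"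
      using sum_list_steps_eq_iff[of w "5 * n - 1" "2 * n"] w us by auto
    have "- int c \<le> weight (sum_list u)"
      using prefix[of "length u"] us length_u \<open>n \<ge> 1\<close> by (simp add: sum_list_weight)
    moreover have "sum_list u + s = (5 * int n - 1, 2 * int n)"
      using total us \<open>n \<ge> 1\<close> by (simp add: of_nat_diff)
    \<comment> \<open>The total weight is -2, so a final East step would leave \<open>u\<close> with
      weight -4, below \<open>-c >= -1\<close>.\<close>
    ultimately have s: "s = (0, 1)"
      using step \<open>c < 2\<close> by (cases "sum_list u") auto
    have "2 * n = Suc (2 * n - 1)"
      using \<open>n \<ge> 1\<close> by simp
    then have "add_mset (0, 1) (mset u) =
        add_mset (0, 1) (replicate_mset (5 * n - 1) (1, 0) + replicate_mset (2 * n - 1) (0, 1))"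
      using w us s by (metis add_mset_add_single mset_append mset_single_iff_right replicate_mset_Suc union_mset_add_mset_right)
    then have "u \<in> U"
      using prefix us length_u \<open>n \<ge> 1\<close> by (force simp: U_def)
    then show "w \<in> (\<lambda>u. u @ [(0, 1)]) ` U"
      using us s by blast
  qed
  finally show ?thesis .
qed

lemma card_permutations_of_two_letters:
  assumes "x \<noteq> y"
  shows "card (permutations_of_multiset (replicate_mset a x + replicate_mset b y)) = (a + b) choose b"
proof -
  let ?X = "replicate_mset a x + replicate_mset b y"
  \<comment> \<open>If \<open>a\<close> or \<open>b\<close> is 0, a letter is missing from
    \<open>?X\<close>; its factor is \<open>fact 0 = 1\<close>.\<close>
  have "(\<Prod>z\<in>set_mset ?X. fact (count ?X z)) = (\<Prod>z\<in>{x, y}. fact (count ?X z) :: nat)"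
    by (rule prod.mono_neutral_left) auto
  also have "\<dots> = fact a * fact b"
    using assms by simp
  finally have "fact (a + b) = card (permutations_of_multiset ?X) * (fact a * fact b :: nat)"
    using card_permutations_of_multiset(2)[of ?X] card_permutations_of_multiset(1)[of ?X]
    by (simp add: dvd_div_mult_self)
  moreover have "fact (a + b) = ((a + b) choose b) * (fact a * fact b :: nat)"
    using binomial_fact_lemma[of b "a + b"] by (simp add: ac_simps)
  ultimately show ?thesis
    by (metis fact_nonzero mult_cancel2 mult_eq_0_iff)
qed

theorem theorem4p2:
  fixes n :: nat
  assumes "n \<ge> 1"
  shows "real (A n) + real (B n) = 2 / (7 * real n - 1) * real ((7 * n - 1) choose (2 * n))"
proof -
  define X :: "(int \<times> int) multiset"
    where "X = replicate_mset (5 * n - 1) (1, 0) + replicate_mset (2 * n) (0, 1)"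
  have size: "size X = 7 * n - 1"
    using assms by (simp add: X_def)
  \<comment> \<open>\<open>2 * (5 * n - 1) - 5 * (2 * n) = -2\<close>, hence \<open>d = 2\<close>
    and the two thresholds 0 and -1.\<close>
  have "(\<Sum>s\<in>#X. weight s) = - int 2"
    using assms by (simp add: X_def of_nat_diff)
  moreover have "X \<noteq> {#}"
    using assms by (simp add: X_def)
  ultimately have "size X * (\<Sum>c<2. card {w \<in> permutations_of_multiset X.
      \<forall>j<size X. - int c \<le> sum_list (map (\<lambda>s. weight s) (take j w))}) =
      2 * card (permutations_of_multiset X)"
    by (rule sum_card_prefix_bounded)
  also have "(\<Sum>c<2. card {w \<in> permutations_of_multiset X.
      \<forall>j<size X. - int c \<le> sum_list (map (\<lambda>s. weight s) (take j w))}) =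
      (\<Sum>c<2. card (paths_below (2/5) (real c / 5) (0, 0) (5 * int n - 1, 2 * int n - 1)))"
    unfolding size by (intro sum.cong) (simp_all only: card_paths_below_eq[OF assms] X_def lessThan_iff)
  \<comment> \<open>The term \<open>c = 0\<close> is \<open>B n\<close> and the term
    \<open>c = 1\<close> is \<open>A n\<close>.\<close>
  also have "\<dots> = A n + B n"
    by (simp add: A_def B_def numeral_2_eq_2)
  also have "card (permutations_of_multiset X) = (7 * n - 1) choose (2 * n)"
    using card_permutations_of_two_letters[of "(1 :: int, 0 :: int)" "(0, 1)" "5 * n - 1" "2 * n"] assms
    by (simp add: X_def)
  finally have "real ((7 * n - 1) * (A n + B n)) = real (2 * ((7 * n - 1) choose (2 * n)))"
    by (simp only: size)
  then have "(7 * real n - 1) * (real (A n) + real (B n)) = 2 * real ((7 * n - 1) choose (2 * n))"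
    using assms by (simp add: of_nat_diff)
  moreover have "7 * real n - 1 > 0"
    using assms by simp
  ultimately show ?thesis
    by (simp add: field_simps)
qed

end
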